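(* Let $C\in[C_-,C_+]$, $T>0$, and consider one coupled mode with initial data $U_0=(u_0,q_0)^T$, $q_0=-a\sigma u_0$, where $u_0$ is independent of $\delta$. Then the fast coefficient $\beta_f$ of $U_0$ satisfies, for $0<\delta\le\delta_0$, $$\beta_f=\frac{\delta\lambda_s^2}{\lambda_f-\lambda_s}u_0,\qquad|\beta_f|\le K\delta^2|u_0|,\qquad\left|\frac{\lambda_f}{\sigma}\beta_f\right|\le K\delta|u_0|.$$ Consequently, with maxima over $0\le n\Delta t\le T$ and $K$ independent of $0<\delta\le\delta_0$ and $\Delta t$, $$\max_n\|U^n-U(t_n)\|\le K(\Delta t+\Delta t^4),\qquad\max_n|u^n-u(t_n)|\le K(\Delta t^2+\Delta t^4).$$ These orders are generically sharp: if $u_0\ne0$, then along a transition sequence $\delta=\kappa\Delta t$, $\Delta t\to0$, with fixed $\kappa>0$ for which $R(-1/\kappa)\ne e^{-1/\kappa}$, the two maxima are bounded below by positive constants times $\Delta t$ and $\Delta t^2$, respectively.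
   Context: Fix $a>0$, $\sigma>0$ and $\delta_0>0$ with $4a\delta_0\sigma^2<1$. For $0<\delta\le\delta_0$ the coupled mode is $U_t=B_\delta U$, $U=(u,q)^T$, where $$B_\delta=\begin{bmatrix}0&\sigma\\-a\sigma/\delta&-1/\delta\end{bmatrix},\qquad\lambda_s=\frac{-1+\sqrt{1-4a\delta\sigma^2}}{2\delta},\quad\lambda_f=\frac{-1-\sqrt{1-4a\delta\sigma^2}}{2\delta}$$ are its slow and fast eigenvalues, with eigenvectors $v_s=(1,\lambda_s/\sigma)^T$, $v_f=(1,\lambda_f/\sigma)^T$. Initial data are decomposed as $U_0=\beta_sv_s+\beta_fv_f$. The exact solution is $U(t)=(u(t),q(t))^T=e^{tB_\delta}U_0$ and the numerical solution is $U^n=(u^n,q^n)^T=R(\Delta tB_\delta)^nU_0$, $t_n=n\Delta t$. Set $C_\pm=\frac{25\pm\sqrt{105}}{780}$, $a_0=\frac16+\frac72C$, $a_1=\frac23-10C$, $a_2=\frac16+\frac{13}2C$, $H(z)=\frac{1+z/4+z^2/48}{1-z/4+z^2/48}$ and $R(z)=\frac{1+a_0z+Cz^2+(a_1z-Cz^2)H(z)}{1-a_2z+\frac32Cz^2}$; $R(M)$ is the rational function of the matrix $M$. *)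

theory Defs
  imports "HOL-Analysis.Analysis"
begin

(* The type class multiplication on real^'n^'n is componentwise, so X ^ k is not the matrix power and
   exp is not the matrix exponential; both are built here from the matrix product **. *)

definition mat_pow :: "real^'n^'n \<Rightarrow> nat \<Rightarrow> real^'n^'n" where
  "mat_pow M k = ((\<lambda>X. M ** X) ^^ k) (mat 1)"

definition mat_exp :: "real^'n^'n \<Rightarrow> real^'n^'n" where
  "mat_exp M = (\<Sum>k. (1 / fact k) *\<^sub>R mat_pow M k)"

definition coupled_mat :: "real \<Rightarrow> real \<Rightarrow> real \<Rightarrow> real^2^2" where
  "coupled_mat a \<sigma> \<delta> = vector [vector [0, \<sigma>], vector [- a * \<sigma> / \<delta>, - 1 / \<delta>]]"

definition lambda_slow :: "real \<Rightarrow> real \<Rightarrow> real \<Rightarrow> real" where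
  "lambda_slow a \<sigma> \<delta> = (- 1 + sqrt (1 - 4 * a * \<delta> * \<sigma>\<^sup>2)) / (2 * \<delta>)"

definition lambda_fast :: "real \<Rightarrow> real \<Rightarrow> real \<Rightarrow> real" where
  "lambda_fast a \<sigma> \<delta> = (- 1 - sqrt (1 - 4 * a * \<delta> * \<sigma>\<^sup>2)) / (2 * \<delta>)"

definition vec_slow :: "real \<Rightarrow> real \<Rightarrow> real \<Rightarrow> real^2" where
  "vec_slow a \<sigma> \<delta> = vector [1, lambda_slow a \<sigma> \<delta> / \<sigma>]"

definition vec_fast :: "real \<Rightarrow> real \<Rightarrow> real \<Rightarrow> real^2" where
  "vec_fast a \<sigma> \<delta> = vector [1, lambda_fast a \<sigma> \<delta> / \<sigma>]"

(* The pair (slow coefficient, fast coefficient). *)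
definition mode_coeffs :: "real \<Rightarrow> real \<Rightarrow> real \<Rightarrow> real^2 \<Rightarrow> real \<times> real" where
  "mode_coeffs a \<sigma> \<delta> U\<^sub>0 =
     (THE (\<beta>\<^sub>s, \<beta>\<^sub>f). U\<^sub>0 = \<beta>\<^sub>s *\<^sub>R vec_slow a \<sigma> \<delta> + \<beta>\<^sub>f *\<^sub>R vec_fast a \<sigma> \<delta>)"

definition fast_coeff :: "real \<Rightarrow> real \<Rightarrow> real \<Rightarrow> real^2 \<Rightarrow> real" where
  "fast_coeff a \<sigma> \<delta> U\<^sub>0 = snd (mode_coeffs a \<sigma> \<delta> U\<^sub>0)"

definition C_minus :: real where "C_minus = (25 - sqrt 105) / 780"
definition C_plus :: real where "C_plus = (25 + sqrt 105) / 780"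

definition coeff_a0 :: "real \<Rightarrow> real" where "coeff_a0 C = 1 / 6 + 7 / 2 * C"
definition coeff_a1 :: "real \<Rightarrow> real" where "coeff_a1 C = 2 / 3 - 10 * C"
definition coeff_a2 :: "real \<Rightarrow> real" where "coeff_a2 C = 1 / 6 + 13 / 2 * C"

definition H :: "real \<Rightarrow> real" where
  "H z = (1 + z / 4 + z\<^sup>2 / 48) / (1 - z / 4 + z\<^sup>2 / 48)"

definition R :: "real \<Rightarrow> real \<Rightarrow> real" where
  "R C z = (1 + coeff_a0 C * z + C * z\<^sup>2 + (coeff_a1 C * z - C * z\<^sup>2) * H z)
           / (1 - coeff_a2 C * z + 3 / 2 * C * z\<^sup>2)"

(* Matrix versions of H and R. For C in [C_minus, C_plus] both denominators are positive at every
   z <= 0, hence invertible matrices whenever the eigenvalues of M are real and negative. *)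

definition H_mat :: "real^'n^'n \<Rightarrow> real^'n^'n" where
  "H_mat M =
     matrix_inv (mat 1 - (1 / 4) *\<^sub>R M + (1 / 48) *\<^sub>R mat_pow M 2)
     ** (mat 1 + (1 / 4) *\<^sub>R M + (1 / 48) *\<^sub>R mat_pow M 2)"

definition R_mat :: "real \<Rightarrow> real^'n^'n \<Rightarrow> real^'n^'n" where
  "R_mat C M =
     matrix_inv (mat 1 - coeff_a2 C *\<^sub>R M + (3 / 2 * C) *\<^sub>R mat_pow M 2)
     ** (mat 1 + coeff_a0 C *\<^sub>R M + C *\<^sub>R mat_pow M 2
         + (coeff_a1 C *\<^sub>R M - C *\<^sub>R mat_pow M 2) ** H_mat M)"

definition exact_sol :: "real \<Rightarrow> real \<Rightarrow> real \<Rightarrow> real^2 \<Rightarrow> real \<Rightarrow> real^2" where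
  "exact_sol a \<sigma> \<delta> U\<^sub>0 t = mat_exp (t *\<^sub>R coupled_mat a \<sigma> \<delta>) *v U\<^sub>0"

definition num_sol :: "real \<Rightarrow> real \<Rightarrow> real \<Rightarrow> real \<Rightarrow> real \<Rightarrow> real^2 \<Rightarrow> nat \<Rightarrow> real^2" where
  "num_sol C a \<sigma> \<delta> \<Delta>t U\<^sub>0 n = mat_pow (R_mat C (\<Delta>t *\<^sub>R coupled_mat a \<sigma> \<delta>)) n *v U\<^sub>0"

definition prepared_data :: "real \<Rightarrow> real \<Rightarrow> real \<Rightarrow> real^2" where
  "prepared_data a \<sigma> u\<^sub>0 = vector [u\<^sub>0, - a * \<sigma> * u\<^sub>0]"

(* Finite and nonempty for dt > 0 and T > 0, so that the maxima below are genuine. *)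
definition time_steps :: "real \<Rightarrow> real \<Rightarrow> nat set" where
  "time_steps T \<Delta>t = {n. 0 \<le> real n * \<Delta>t \<and> real n * \<Delta>t \<le> T}"

definition max_err :: "real \<Rightarrow> real \<Rightarrow> real \<Rightarrow> real \<Rightarrow> real \<Rightarrow> real \<Rightarrow> real^2 \<Rightarrow> real" where
  "max_err C a \<sigma> T \<delta> \<Delta>t U\<^sub>0 =
     Max ((\<lambda>n. norm (num_sol C a \<sigma> \<delta> \<Delta>t U\<^sub>0 n - exact_sol a \<sigma> \<delta> U\<^sub>0 (real n * \<Delta>t)))
          ` time_steps T \<Delta>t)"

definition max_err_u :: "real \<Rightarrow> real \<Rightarrow> real \<Rightarrow> real \<Rightarrow> real \<Rightarrow> real \<Rightarrow> real^2 \<Rightarrow> real" where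
  "max_err_u C a \<sigma> T \<delta> \<Delta>t U\<^sub>0 =
     Max ((\<lambda>n. \<bar>num_sol C a \<sigma> \<delta> \<Delta>t U\<^sub>0 n $ 1 - exact_sol a \<sigma> \<delta> U\<^sub>0 (real n * \<Delta>t) $ 1\<bar>)
          ` time_steps T \<Delta>t)"

lemma lambda_fast_less_slow:
  assumes "0 < \<delta>" "4 * a * \<delta> * \<sigma>\<^sup>2 < 1"
  shows "lambda_fast a \<sigma> \<delta> < lambda_slow a \<sigma> \<delta>"
proof -
  have "0 < sqrt (1 - 4 * a * \<delta> * \<sigma>\<^sup>2)" using assms by simp
  then show ?thesis
    unfolding lambda_fast_def lambda_slow_def using assms by (intro divide_strict_right_mono) auto
qed

lemma mode_decomposition_ex1:
  assumes "0 < \<delta>" "0 < \<sigma>" "4 * a * \<delta> * \<sigma>\<^sup>2 < 1"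
  shows "\<exists>!(\<beta>\<^sub>s, \<beta>\<^sub>f). U\<^sub>0 = \<beta>\<^sub>s *\<^sub>R vec_slow a \<sigma> \<delta> + \<beta>\<^sub>f *\<^sub>R vec_fast a \<sigma> \<delta>"
proof -
  define s f where "s = lambda_slow a \<sigma> \<delta>" and "f = lambda_fast a \<sigma> \<delta>"
  have ne: "f - s \<noteq> 0" using lambda_fast_less_slow[OF assms(1,3)] by (simp add: s_def f_def)
  define bf where "bf = (\<sigma> * U\<^sub>0 $ 2 - s * U\<^sub>0 $ 1) / (f - s)"
  have "U\<^sub>0 = x *\<^sub>R vec_slow a \<sigma> \<delta> + y *\<^sub>R vec_fast a \<sigma> \<delta> \<longleftrightarrow> (x, y) = (U\<^sub>0 $ 1 - bf, bf)" for x y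
  proof -
    have "U\<^sub>0 = x *\<^sub>R vec_slow a \<sigma> \<delta> + y *\<^sub>R vec_fast a \<sigma> \<delta>
        \<longleftrightarrow> U\<^sub>0 $ 1 = x + y \<and> \<sigma> * U\<^sub>0 $ 2 = x * s + y * f"
      using assms(2)
      by (simp add: vec_eq_iff forall_2 vec_slow_def vec_fast_def s_def f_def field_simps)
    also have "\<dots> \<longleftrightarrow> x = U\<^sub>0 $ 1 - y \<and> \<sigma> * U\<^sub>0 $ 2 = (U\<^sub>0 $ 1 - y) * s + y * f"
      by auto
    also have "\<dots> \<longleftrightarrow> x = U\<^sub>0 $ 1 - y \<and> y * (f - s) = \<sigma> * U\<^sub>0 $ 2 - s * U\<^sub>0 $ 1"
      by (auto simp: algebra_simps)
    also have "\<dots> \<longleftrightarrow> x = U\<^sub>0 $ 1 - y \<and> y = bf"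
      using ne by (simp add: bf_def eq_divide_eq)
    finally show ?thesis by auto
  qed
  then show ?thesis by auto
qed

end

theory Submission
  imports Defs
begin

text \<open>In the basis of slow and fast eigenvectors both solutions are diagonal, so the error consists of
  \<open>\<beta>\<^sub>s (R(\<Delta>t \<lambda>\<^sub>s)\<^sup>n - e\<^bsup>n \<Delta>t \<lambda>\<^sub>s\<^esup>)\<close> and the analogous fast term. On the negative axis
  \<open>R\<close> is a cubic over a quartic with \<open>|R| \<le> 1\<close>, it contracts like \<open>1 - |z|/3\<close> on \<open>[-1, 0]\<close>, and it
  agrees with \<open>e\<^sup>z\<close> up to \<open>|z|\<^sup>5\<close>. The contraction sums the local errors, giving
  \<open>|R(z)\<^sup>n - e\<^bsup>nz\<^esup>| \<le> 3|z|\<^sup>k\<close> for all \<open>n\<close>, all \<open>z \<le> 0\<close> and all \<open>k \<le> 4\<close>. The slow mode uses \<open>k = 4\<close>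
  with \<open>\<lambda>\<^sub>s\<close> bounded. The fast mode uses \<open>|\<lambda>\<^sub>f| \<le> 1/\<delta>\<close> with \<open>k = 2\<close> for \<open>u\<close>, where the factor
  \<open>\<beta>\<^sub>f = O(\<delta>\<^sup>2)\<close> cancels \<open>\<delta>\<^sup>-\<^sup>2\<close>, and with \<open>k = 1\<close> for \<open>q\<close>, where the factor is only \<open>O(\<delta>)\<close>.\<close>

section \<open>Scalar estimates for the stability function\<close>

text \<open>Numerator and denominator of \<open>R C (- x)\<close>, both multiplied by the denominator of \<open>H (- x)\<close>. The
  terms of degree 4 in the numerator cancel.\<close>

definition R_num :: "real \<Rightarrow> real \<Rightarrow> real" where
  "R_num C x = 1 + (13/2 * C - 7/12) * x + (7/48 - 27/8 * C) * x^2 + (61/96 * C - 5/288) * x^3"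

definition R_den :: "real \<Rightarrow> real \<Rightarrow> real" where
  "R_den C x = 1 + (13/2 * C + 5/12) * x + (25/8 * C + 1/16) * x^2 + (49/96 * C + 1/288) * x^3
     + C/32 * x^4"

text \<open>Rational bounds replacing the irrational endpoints; every later sign condition on a
  coefficient in \<open>C\<close> follows from them.\<close>

lemma C_bounds:
  assumes "C \<in> {C_minus..C_plus}"
  shows "1/60 < C" "C < 1/20"
proof -
  have "sqrt 105 < 11" by (rule real_less_lsqrt) auto
  then show "1/60 < C" "C < 1/20" using assms by (auto simp: C_minus_def C_plus_def field_simps)
qed

lemma H_den_pos: "1 - z/4 + z^2/48 > (0::real)" for z :: real
proof -
  have "1 - z/4 + z^2/48 = (z - 6)^2/48 + 1/4" by (simp add: power2_eq_square field_simps)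
  also have "\<dots> > 0" by (intro add_nonneg_pos) auto
  finally show ?thesis .
qed

lemma R_den1_pos:
  assumes "C > 0" "z \<le> 0"
  shows "1 - coeff_a2 C * z + 3/2 * C * z^2 > 0"
proof -
  have "coeff_a2 C * z \<le> 0" using assms by (simp add: coeff_a2_def mult_nonneg_nonpos)
  moreover have "3/2 * C * z^2 \<ge> 0" using assms by simp
  ultimately show ?thesis by linarith
qed

lemma R_den_ge_1: "C \<ge> 0 \<Longrightarrow> x \<ge> 0 \<Longrightarrow> R_den C x \<ge> 1"
  unfolding R_den_def by simp

lemma R_eq_num_den:
  assumes "C > 0" "x \<ge> 0"
  shows "R C (- x) = R_num C x / R_den C x"
proof -
  define p where "p = 1 + x/4 + x^2/48"
  define m where "m = 1 - x/4 + x^2/48"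
  define d where "d = 1 + coeff_a2 C * x + 3/2 * C * x^2"
  have p: "p > 0" using H_den_pos[of "-x"] by (simp add: p_def)
  have d: "d > 0" using R_den1_pos[of C "-x"] assms by (simp add: d_def)
  have "R C (- x) = (1 - coeff_a0 C * x + C * x^2 + (- coeff_a1 C * x - C * x^2) * (m / p)) / d"
    by (simp add: R_def H_def p_def m_def d_def)
  also have "\<dots> = ((1 - coeff_a0 C * x + C * x^2) * p + (- coeff_a1 C * x - C * x^2) * m) / (d * p)"
    using p d by (simp add: field_simps)
  also have "(1 - coeff_a0 C * x + C * x^2) * p + (- coeff_a1 C * x - C * x^2) * m = R_num C x"
    unfolding R_num_def p_def m_def coeff_a0_def coeff_a1_def by (simp add: field_simps eval_nat_numeral)
  also have "d * p = R_den C x"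
    unfolding R_den_def p_def d_def coeff_a2_def by (simp add: field_simps eval_nat_numeral)
  finally show ?thesis .
qed

text \<open>Every coefficient of the difference is nonnegative for these \<open>C\<close>, and the
  linear one is exactly 1. That term \<open>x\<close> later produces strict contraction near
  0.\<close>

lemma R_den_minus_num:
  assumes "1/60 < C" "C < 1/20" "x \<ge> 0"
  shows "x \<le> R_den C x - R_num C x"
proof -
  have "R_den C x - R_num C x = x + (13/2 * C - 1/12) * x^2 + (1/48 - C/8) * x^3 + C/32 * x^4"
    unfolding R_den_def R_num_def by (simp add: field_simps eval_nat_numeral)
  moreover have "(13/2 * C - 1/12) * x^2 \<ge> 0" "(1/48 - C/8) * x^3 \<ge> 0" "C/32 * x^4 \<ge> 0"
    using assms by simp_all
  ultimately show ?thesis by linarith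
qed

lemma R_den_plus_num:
  assumes "1/60 < C" "C < 1/20" "x \<ge> 0"
  shows "2 \<le> R_den C x + R_num C x"
proof -
  have "R_den C x + R_num C x = 2 + (13 * C - 1/6) * x + (5/24 - C/4) * x^2 + (55/48 * C - 1/72) * x^3 + C/32 * x^4"
    unfolding R_den_def R_num_def by (simp add: field_simps eval_nat_numeral)
  moreover have "(13 * C - 1/6) * x \<ge> 0" "(5/24 - C/4) * x^2 \<ge> 0" "(55/48 * C - 1/72) * x^3 \<ge> 0" "C/32 * x^4 \<ge> 0"
    using assms by simp_all
  ultimately show ?thesis by linarith
qed

text \<open>As \<open>R_den\<close> is positive, the claim reduces to the signs of
  \<open>R_den\<close> minus \<open>R_num\<close> and \<open>R_den\<close> plus
  \<open>R_num\<close>.\<close>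

lemma abs_R_le_1:
  assumes "1/60 < C" "C < 1/20" "x \<ge> 0"
  shows "\<bar>R C (- x)\<bar> \<le> 1"
proof -
  have "R_den C x \<ge> 1" using R_den_ge_1 assms by simp
  then show ?thesis using R_den_minus_num[OF assms] R_den_plus_num[OF assms] assms
    by (simp add: R_eq_num_den abs_le_iff field_simps)
qed

text \<open>The nonconstant coefficients add up to less than 1 when \<open>C < 1/20\<close>.\<close>

lemma R_den_le_2:
  assumes "1/60 < C" "C < 1/20" "x \<ge> 0" "x \<le> 1"
  shows "R_den C x \<le> 2"
proof -
  have "x^k \<le> 1" for k using assms by (simp add: power_le_one)
  then have "(13/2 * C + 5/12) * x \<le> 13/2 * C + 5/12"
      "(25/8 * C + 1/16) * x^2 \<le> 25/8 * C + 1/16"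
      "(49/96 * C + 1/288) * x^3 \<le> 49/96 * C + 1/288" "C/32 * x^4 \<le> C/32"
    using assms by (intro mult_left_le; simp)+
  then show ?thesis using assms unfolding R_den_def by linarith
qed

text \<open>Dividing the gap \<open>x\<close> by a denominator between 1 and 2 keeps at least
  \<open>x/2\<close>, so the rate \<open>x/3\<close> holds with room to spare. The same rate is
  later shown for \<open>exp (- x)\<close>.\<close>

lemma abs_R_contraction:
  assumes "1/60 < C" "C < 1/20" "x \<ge> 0" "x \<le> 1"
  shows "\<bar>R C (- x)\<bar> \<le> 1 - x/3"
proof -
  let ?D = "R_den C x" and ?N = "R_num C x"
  have D: "?D \<ge> 1" "?D \<le> 2" using R_den_ge_1 R_den_le_2 assms by auto
  have "x/3 * ?D \<le> x/3 * 2" using D assms by (intro mult_left_mono) auto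
  then have "?N \<le> (1 - x/3) * ?D" "- ?N \<le> (1 - x/3) * ?D"
    using R_den_minus_num[OF assms(1-3)] R_den_plus_num[OF assms(1-3)] assms
    by (simp_all add: algebra_simps)
  then show ?thesis using D assms
    by (simp add: R_eq_num_den abs_le_iff pos_divide_le_eq flip: minus_divide_left)
qed

lemma R_minus_exp_le:
  assumes "1/60 < C" "C < 1/20" "x \<ge> 0" "x \<le> 1"
  shows "\<bar>R C (- x) - exp (- x)\<bar> \<le> x^5"
proof -
  define p where "p = 1 - x + x^2/2 - x^3/6 + x^4/24"
  let ?D = "R_den C x" and ?N = "R_num C x"
  obtain t where t: "\<bar>t\<bar> \<le> \<bar>- x\<bar>"
      and e: "exp (- x) = (\<Sum>m<5. ((- x) ^ m) / fact m) + (exp t / fact 5) * (- x) ^ 5"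
    using Maclaurin_exp_le by blast
  have "exp (- x) - p = - (exp t / 120 * x^5)"
    using e by (simp add: p_def eval_nat_numeral)
  moreover have "exp t \<le> 3"
  proof -
    have "exp t \<le> exp 1" using t assms by simp
    then show ?thesis using exp_le by linarith
  qed
  then have "exp t / 120 * x^5 \<le> 3 / 120 * x^5" using assms by (intro mult_right_mono) auto
  moreover have "0 \<le> exp t / 120 * x^5" using assms by simp
  ultimately have ep: "\<bar>p - exp (- x)\<bar> \<le> 3 / 120 * x^5" by linarith
  \<comment> \<open>In \<open>?N - p * ?D\<close> all terms up to degree 4 cancel, identically in
    \<open>C\<close>; this is the fourth-order accuracy of \<open>R\<close>. The cubic
    \<open>g\<close> is what remains after dividing by \<open>x^5\<close>.\<close>
  define g where "g = (5/192 * C - 5/576) + (- 35/576 * C - 7/3456) * x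
    + (- 37/2304 * C - 1/6912) * x^2 - C/768 * x^3"
  have Np: "?N - p * ?D = x^5 * g"
    unfolding R_num_def R_den_def p_def g_def by (simp add: field_simps eval_nat_numeral)
  have xk: "0 \<le> x^k" "x^k \<le> 1" for k using assms by (simp_all add: power_le_one)
  \<comment> \<open>Four crude bounds of 1/8 suffice: their sum 1/2, with 3/120 from the Taylor
    remainder, stays below 1.\<close>
  have "\<bar>5/192 * C - 5/576\<bar> \<le> 1/8" "\<bar>(- 35/576 * C - 7/3456) * x\<bar> \<le> 1/8 * 1"
    "\<bar>(- 37/2304 * C - 1/6912) * x^2\<bar> \<le> 1/8 * 1" "\<bar>C/768 * x^3\<bar> \<le> 1/8 * 1"
    using assms xk unfolding abs_mult by ((intro mult_mono)?; simp)+
  then have g: "\<bar>g\<bar> \<le> 1/2" unfolding g_def by linarith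
  have D: "?D \<ge> 1" using R_den_ge_1 assms by auto
  have "\<bar>?N - p * ?D\<bar> \<le> 1/2 * x^5"
    unfolding Np abs_mult using mult_right_mono[OF g xk(1)[of 5]] xk(1)[of 5] by (simp add: mult.commute)
  moreover have "?N / ?D - p = (?N - p * ?D) / ?D" using D by (simp add: field_simps)
  then have "\<bar>?N / ?D - p\<bar> \<le> \<bar>?N - p * ?D\<bar>"
    using D by (simp add: abs_divide divide_le_eq mult_le_cancel_left1)
  ultimately have "\<bar>?N / ?D - exp (- x)\<bar> \<le> 1/2 * x^5 + 3/120 * x^5"
    using ep by linarith
  also have "\<dots> \<le> x^5" using xk[of 5] by simp
  finally show ?thesis using assms by (simp add: R_eq_num_den)
qed

section \<open>From one-step errors to errors of powers\<close>

lemma abs_power_diff_le: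
  fixes w e r :: real
  assumes "\<bar>w\<bar> \<le> r" "\<bar>e\<bar> \<le> r"
  shows "\<bar>w^n - e^n\<bar> \<le> real n * r^(n-1) * \<bar>w - e\<bar>"
proof (cases n)
  case (Suc m)
  have r0: "r \<ge> 0" using assms by linarith
  \<comment> \<open>This sum is the cofactor of \<open>w - e\<close> in \<open>w^n - e^n\<close>;
    each of its \<open>n\<close> terms has total degree \<open>n-1\<close>.\<close>
  have "\<bar>\<Sum>i<n. e^(n - Suc i) * w^i\<bar> \<le> (\<Sum>i<n. r^(n-1))"
  proof (rule order_trans[OF sum_abs sum_mono])
    fix i assume i: "i \<in> {..<n}"
    have "\<bar>e^(n - Suc i) * w^i\<bar> \<le> r^(n - Suc i) * r^i"
      unfolding abs_mult power_abs using assms r0 by (intro mult_mono power_mono) auto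
    also have "\<dots> = r^(n-1)" using i by (simp flip: power_add)
    finally show "\<bar>e^(n - Suc i) * w^i\<bar> \<le> r^(n-1)" .
  qed
  then show ?thesis
    by (simp add: power_diff_sumr2[of w n e] abs_mult mult.commute mult_left_mono del: sum_constant)
       (simp add: mult_left_mono)
qed simp

text \<open>The last power is the smallest, so \<open>n\<close> copies of it are dominated by the
  geometric sum, which telescopes against \<open>1 - r\<close>. This makes the accumulated error
  independent of \<open>n\<close>.\<close>

lemma real_mult_power_le:
  fixes r :: real
  assumes "0 \<le> r" "r \<le> 1"
  shows "real n * r^(n-1) * (1 - r) \<le> 1"
proof -
  have "real n * r^(n-1) = (\<Sum>i<n. r^(n-1))" by simp
  also have "\<dots> \<le> (\<Sum>i<n. r^i)" using assms by (intro sum_mono power_decreasing) auto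
  finally have "real n * r^(n-1) * (1 - r) \<le> (\<Sum>i<n. r^i) * (1 - r)"
    using assms by (intro mult_right_mono) auto
  also have "\<dots> = 1 - r^n" by (simp add: one_diff_power_eq mult.commute)
  also have "\<dots> \<le> 1" using assms by simp
  finally show ?thesis .
qed

text \<open>Contraction at rate \<open>x/3\<close> outweighs the accumulation of local errors, so
  the bound is uniform in \<open>n\<close>. The value 2 is the trivial bound from both powers having
  modulus at most 1.\<close>

lemma R_power_minus_exp_le_4:
  assumes C: "1/60 < C" "C < 1/20" and x: "x \<ge> 0"
  shows "\<bar>R C (- x) ^ n - exp (- x) ^ n\<bar> \<le> min 2 (3 * x^4)"
proof -
  let ?w = "R C (- x)" and ?e = "exp (- x)"
  have "\<bar>?w ^ n\<bar> \<le> 1" unfolding power_abs using abs_R_le_1[OF C x] by (simp add: power_le_one)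
  moreover have "\<bar>?e ^ n\<bar> \<le> 1" unfolding power_abs using x by (simp add: power_le_one)
  ultimately have two: "\<bar>?w^n - ?e^n\<bar> \<le> 2" by linarith
  moreover have "\<bar>?w^n - ?e^n\<bar> \<le> 3 * x^4"
  proof (cases "0 < x \<and> x \<le> 1")
    case True
    have "?e \<le> 1 - x/3"
    proof -
      have "(1 + x) * ?e \<le> exp x * ?e" by (intro mult_right_mono) auto
      then have "(1 + x) * ?e \<le> 1" by (simp flip: exp_add)
      moreover have "1 \<le> (1 + x) * (1 - x/3)"
      proof -
        have "x * x \<le> x * 1" using True by (intro mult_left_mono) auto
        then show ?thesis using True by (simp add: algebra_simps)
      qed
      ultimately have "(1 + x) * ?e \<le> (1 + x) * (1 - x/3)" by linarith
      then show ?thesis using True by simp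
    qed
    then have "\<bar>?w^n - ?e^n\<bar> \<le> real n * (1 - x/3)^(n-1) * \<bar>?w - ?e\<bar>"
      using abs_R_contraction C True by (intro abs_power_diff_le) auto
    also have "\<dots> \<le> real n * (1 - x/3)^(n-1) * x^5"
      using R_minus_exp_le C True by (intro mult_left_mono) auto
    \<comment> \<open>One factor \<open>x\<close> of the local error \<open>x^5\<close> is spent as
      \<open>3 * (1 - r)\<close> with \<open>r = 1 - x/3\<close>, lowering the order from 5 to
      4.\<close>
    also have "\<dots> = (real n * (1 - x/3)^(n-1) * (1 - (1 - x/3))) * (3 * x^4)"
      by (simp add: eval_nat_numeral)
    also have "\<dots> \<le> 1 * (3 * x^4)"
      using True by (intro mult_right_mono real_mult_power_le) auto
    finally show ?thesis by simp
  next
    \<comment> \<open>What remains is \<open>x = 0\<close>, where both powers are 1, and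
      \<open>x > 1\<close>, where the trivial bound 2 lies below \<open>3 * x^4\<close>.\<close>
    case False
    show ?thesis
    proof (cases "x = 0")
      case True
      then show ?thesis by (simp add: R_def)
    next
      case nz: False
      then have "1 \<le> x^4" using False x by simp
      then show ?thesis using two by linarith
    qed
  qed
  ultimately show ?thesis by simp
qed

text \<open>Up to modulus 1 a lower power is only larger; beyond it the bound 2 takes over. The
  freedom in \<open>k\<close> lets the fast mode match powers of \<delta> in its
  coefficient.\<close>

lemma R_power_minus_exp_le:
  assumes "1/60 < C" "C < 1/20" "z \<le> 0" "k \<le> 4"
  shows "\<bar>R C z ^ n - exp (real n * z)\<bar> \<le> 3 * \<bar>z\<bar>^k"
proof -
  define x where "x = - z"
  have x: "x \<ge> 0" "z = - x" using assms by (auto simp: x_def)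
  have m: "\<bar>R C z ^ n - exp (real n * z)\<bar> \<le> min 2 (3 * x^4)"
    using R_power_minus_exp_le_4[of C x n] assms x by (simp add: exp_of_nat_mult[symmetric])
  show ?thesis
  proof (cases "x \<le> 1")
    case True
    then have "x^4 \<le> x^k" using x assms by (intro power_decreasing) auto
    then show ?thesis using m x by simp
  next
    case False
    then have "1 \<le> x^k" by (simp add: one_le_power)
    then show ?thesis using m x by simp
  qed
qed

section \<open>Functional calculus for two eigenvalues\<close>

text \<open>For an idempotent \<open>P\<close> this is the matrix with eigenvalue \<open>s\<close> on the range of \<open>P\<close> and eigenvalue
  \<open>f\<close> on its kernel.\<close>

definition spectral :: "real^'n^'n \<Rightarrow> real \<Rightarrow> real \<Rightarrow> real^'n^'n" where
  "spectral P s f = f *\<^sub>R mat 1 + (s - f) *\<^sub>R P"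

lemma matrix_add_rdistrib: "(A + B) ** C = A ** C + B ** C"
  for A B :: "real^'n^'m" and C :: "real^'p^'n"
  by (vector matrix_matrix_mult_def sum.distrib[symmetric] field_simps)

lemma spectral_one: "spectral P 1 1 = mat 1"
  by (simp add: spectral_def)

lemma spectral_add: "spectral P s f + spectral P s' f' = spectral P (s + s') (f + f')"
  by (simp add: spectral_def algebra_simps)

lemma spectral_diff: "spectral P s f - spectral P s' f' = spectral P (s - s') (f - f')"
  by (simp add: spectral_def algebra_simps)

lemma spectral_scaleR: "k *\<^sub>R spectral P s f = spectral P (k * s) (k * f)"
  by (simp add: spectral_def algebra_simps)

text \<open>Idempotence folds the quadratic term back into \<open>P\<close>. With the linear rules,
  \<open>spectral P\<close> becomes a ring homomorphism from pairs of reals, so rational functions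
  act on the eigenvalues.\<close>

lemma spectral_mult:
  assumes "P ** P = P"
  shows "spectral P s f ** spectral P s' f' = spectral P (s * s') (f * f')"
proof -
  have "spectral P s f ** spectral P s' f'
    = (f * f') *\<^sub>R mat 1 + (f * (s' - f') + (s - f) * f' + (s - f) * (s' - f')) *\<^sub>R P"
    using assms
    by (simp add: spectral_def matrix_add_ldistrib matrix_add_rdistrib matrix_scalar_ac
        flip: scalar_matrix_assoc) (simp add: algebra_simps)
  also have "f * (s' - f') + (s - f) * f' + (s - f) * (s' - f') = s * s' - f * f'"
    by (simp add: algebra_simps)
  finally show ?thesis by (simp add: spectral_def)
qed

lemma spectral_pow:
  assumes "P ** P = P"
  shows "mat_pow (spectral P s f) k = spectral P (s^k) (f^k)"
  by (induction k) (auto simp: mat_pow_def spectral_one spectral_mult[OF assms])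

lemma spectral_inv:
  assumes "P ** P = P" "s \<noteq> 0" "f \<noteq> 0"
  shows "matrix_inv (spectral P s f) = spectral P (1/s) (1/f)"
proof -
  let ?A = "spectral P s f" and ?B = "spectral P (1/s) (1/f)"
  have AB: "?A ** ?B = mat 1" "?B ** ?A = mat 1"
    using assms by (simp_all add: spectral_mult spectral_one)
  \<comment> \<open>\<open>matrix_inv\<close> chooses some two-sided inverse; the explicit
    \<open>?B\<close> shows that one exists and then identifies it.\<close>
  have "?A ** matrix_inv ?A = mat 1"
    unfolding matrix_inv_def using AB by (rule someI2[where Q = "\<lambda>X. ?A ** X = mat 1", OF conjI]) simp
  then have "?B ** (?A ** matrix_inv ?A) = ?B" by simp
  then show ?thesis by (simp add: matrix_mul_assoc AB)
qed

text \<open>The exponential series converges separately in the scalar coefficients of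
  \<open>mat 1\<close> and \<open>P\<close>.\<close>

lemma spectral_exp:
  assumes "P ** P = P"
  shows "mat_exp (spectral P s f) = spectral P (exp s) (exp f)"
proof -
  have e: "(\<lambda>k. 1 / fact k * x^k) sums exp x" for x :: real
    using exp_converges[of x] by (simp add: divide_inverse mult.commute)
  have "(\<lambda>k. spectral P (1 / fact k * s^k) (1 / fact k * f^k)) sums spectral P (exp s) (exp f)"
    unfolding spectral_def by (intro sums_add sums_scaleR_left sums_diff e)
  then show ?thesis
    unfolding mat_exp_def spectral_pow[OF assms] spectral_scaleR by (simp add: sums_iff)
qed

lemma spectral_H:
  assumes "P ** P = P"
  shows "H_mat (spectral P s f) = spectral P (H s) (H f)"
proof -
  have "1 - 1/4 * z + 1/48 * z^2 \<noteq> 0" for z :: real using H_den_pos[of z] by simp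
  then show ?thesis
    \<comment> \<open>Writing the identity as \<open>spectral P 1 1\<close> makes every matrix in
      the formula spectral, leaving arithmetic on pairs.\<close>
    unfolding H_mat_def H_def spectral_pow[OF assms] spectral_one[of P, symmetric]
    by (simp only: spectral_add spectral_diff spectral_scaleR spectral_inv[OF assms] spectral_mult[OF assms]
        not_False_eq_True) simp
qed

text \<open>The signs of the eigenvalues enter through the outer denominator, positive for
  \<open>z \<le> 0\<close>; that of \<open>H\<close> is positive on the whole line.\<close>

lemma spectral_R:
  assumes "P ** P = P" "C > 0" "s \<le> 0" "f \<le> 0"
  shows "R_mat C (spectral P s f) = spectral P (R C s) (R C f)"
proof -
  have "1 - coeff_a2 C * z + 3/2 * C * z^2 \<noteq> 0" if "z \<le> 0" for z
    using R_den1_pos[of C z] that assms by simp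
  then have "1 - coeff_a2 C * s + 3/2 * C * s^2 \<noteq> 0" "1 - coeff_a2 C * f + 3/2 * C * f^2 \<noteq> 0"
    using assms by auto
  then show ?thesis
    unfolding R_mat_def R_def spectral_pow[OF assms(1)] spectral_one[of P, symmetric] spectral_H[OF assms(1)]
    by (simp only: spectral_add spectral_diff spectral_scaleR spectral_inv[OF assms(1)] spectral_mult[OF assms(1)]
        not_False_eq_True) simp
qed

lemma spectral_mult_vec:
  "P *v v = v \<Longrightarrow> spectral P s f *v v = s *\<^sub>R v"
  "P *v v = 0 \<Longrightarrow> spectral P s f *v v = f *\<^sub>R v"
  by (simp_all add: spectral_def matrix_vector_mult_add_rdistrib algebra_simps
      flip: scaleR_matrix_vector_assoc)

section \<open>Slow and fast modes\<close>

text \<open>The spectral projection onto the slow eigenvector along the fast one: the coupled matrix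
  minus \<open>f\<close> times the identity, divided by \<open>s - f\<close>, with entries rewritten
  by Vieta's formulas.\<close>

definition slow_proj :: "real \<Rightarrow> real \<Rightarrow> real \<Rightarrow> real^2^2" where
  "slow_proj a \<sigma> \<delta> = (let s = lambda_slow a \<sigma> \<delta>; f = lambda_fast a \<sigma> \<delta> in
     (1 / (s - f)) *\<^sub>R vector [vector [- f, \<sigma>], vector [- s * f / \<sigma>, s]])"

text \<open>A closed form that avoids the definite description in \<open>mode_coeffs\<close>;
  \<open>fast_coeff_prepared\<close> identifies the two.\<close>

definition prepared_fast :: "real \<Rightarrow> real \<Rightarrow> real \<Rightarrow> real \<Rightarrow> real" where
  "prepared_fast a \<sigma> \<delta> u = \<delta> * (lambda_slow a \<sigma> \<delta>)\<^sup>2 / (lambda_fast a \<sigma> \<delta> - lambda_slow a \<sigma> \<delta>) * u"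

context
  fixes a \<sigma> \<delta> :: real
  assumes a: "a > 0" and \<sigma>: "\<sigma> > 0" and \<delta>: "\<delta> > 0" and disc: "4 * a * \<delta> * \<sigma>\<^sup>2 < 1"
begin

lemma lambda_sum: "lambda_slow a \<sigma> \<delta> + lambda_fast a \<sigma> \<delta> = - 1 / \<delta>"
  using \<delta> by (simp add: lambda_slow_def lambda_fast_def field_simps)

lemma lambda_mult: "lambda_slow a \<sigma> \<delta> * lambda_fast a \<sigma> \<delta> = a * \<sigma>\<^sup>2 / \<delta>"
proof -
  define D where "D = sqrt (1 - 4 * a * \<delta> * \<sigma>\<^sup>2)"
  have "D^2 = 1 - 4 * a * \<delta> * \<sigma>\<^sup>2" using disc by (simp add: D_def)
  then have "(- 1 + D) * (- 1 - D) = 4 * a * \<delta> * \<sigma>\<^sup>2" by (simp add: algebra_simps power2_eq_square)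
  then have "(- 1 + D) / (2 * \<delta>) * ((- 1 - D) / (2 * \<delta>)) = 4 * a * \<delta> * \<sigma>\<^sup>2 / (4 * \<delta> * \<delta>)" by simp
  also have "\<dots> = a * \<sigma>\<^sup>2 / \<delta>" using \<delta> by simp
  finally show ?thesis by (simp add: lambda_slow_def lambda_fast_def D_def)
qed

lemma lambda_diff: "lambda_fast a \<sigma> \<delta> - lambda_slow a \<sigma> \<delta> = - sqrt (1 - 4 * a * \<delta> * \<sigma>\<^sup>2) / \<delta>"
  using \<delta> by (simp add: lambda_slow_def lambda_fast_def field_simps)

text \<open>Rationalising the numerator cancels the division by \<delta>, so the slow eigenvalue
  visibly stays bounded as \<delta> tends to 0.\<close>

lemma lambda_slow_eq: "lambda_slow a \<sigma> \<delta> = - 2 * a * \<sigma>\<^sup>2 / (1 + sqrt (1 - 4 * a * \<delta> * \<sigma>\<^sup>2))"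
proof -
  define D where "D = sqrt (1 - 4 * a * \<delta> * \<sigma>\<^sup>2)"
  have D: "D^2 = 1 - 4 * a * \<delta> * \<sigma>\<^sup>2" "D \<ge> 0" using disc by (simp_all add: D_def)
  have "(- 1 + D) * (1 + D) = - 4 * a * \<delta> * \<sigma>\<^sup>2"
    using D(1) by (simp add: algebra_simps power2_eq_square)
  then show ?thesis
    using D(2) \<delta> unfolding lambda_slow_def D_def[symmetric] by (simp add: field_simps)
qed

lemma lambda_slow_bounds: "lambda_slow a \<sigma> \<delta> < 0" "\<bar>lambda_slow a \<sigma> \<delta>\<bar> \<le> 2 * a * \<sigma>\<^sup>2"
proof -
  define D where "D = sqrt (1 - 4 * a * \<delta> * \<sigma>\<^sup>2)"
  have D: "D \<ge> 0" using disc by (simp add: D_def)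
  have n: "2 * a * \<sigma>\<^sup>2 > 0" using a \<sigma> by simp
  show "lambda_slow a \<sigma> \<delta> < 0" using D n unfolding lambda_slow_eq D_def[symmetric]
    by (simp add: divide_neg_pos)
  have "2 * a * \<sigma>\<^sup>2 / (1 + D) \<le> 2 * a * \<sigma>\<^sup>2 / 1"
    using D n by (intro divide_left_mono) auto
  moreover have "0 \<le> 2 * a * \<sigma>\<^sup>2 / (1 + D)" using D n by simp
  moreover have "lambda_slow a \<sigma> \<delta> = - (2 * a * \<sigma>\<^sup>2 / (1 + D))"
    unfolding lambda_slow_eq D_def[symmetric] by simp
  ultimately show "\<bar>lambda_slow a \<sigma> \<delta>\<bar> \<le> 2 * a * \<sigma>\<^sup>2" by linarith
qed

text \<open>Both eigenvalues are negative with sum \<open>- 1 / \<delta>\<close>, so neither can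
  exceed \<open>1 / \<delta>\<close> in modulus.\<close>

lemma lambda_fast_bounds: "lambda_fast a \<sigma> \<delta> < 0" "\<bar>lambda_fast a \<sigma> \<delta>\<bar> \<le> 1 / \<delta>"
proof -
  have "0 < sqrt (1 - 4 * a * \<delta> * \<sigma>\<^sup>2)" using disc by simp
  then show 1: "lambda_fast a \<sigma> \<delta> < 0"
    unfolding lambda_fast_def using \<delta> by (intro divide_neg_pos) linarith+
  show "\<bar>lambda_fast a \<sigma> \<delta>\<bar> \<le> 1 / \<delta>" using 1 lambda_sum lambda_slow_bounds(1) by simp
qed

lemma lambda_fast_neq_slow: "lambda_slow a \<sigma> \<delta> - lambda_fast a \<sigma> \<delta> \<noteq> 0"
  using lambda_fast_less_slow[OF \<delta> disc] by simp

lemma slow_proj_idem: "slow_proj a \<sigma> \<delta> ** slow_proj a \<sigma> \<delta> = slow_proj a \<sigma> \<delta>"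
proof -
  define s f where "s = lambda_slow a \<sigma> \<delta>" and "f = lambda_fast a \<sigma> \<delta>"
  let ?X = "vector [vector [- f, \<sigma>], vector [- s * f / \<sigma>, s]] :: real^2^2"
  \<comment> \<open>Cayley-Hamilton for a matrix with determinant 0 and trace
    \<open>s - f\<close>.\<close>
  have "?X ** ?X = (s - f) *\<^sub>R ?X"
    using \<sigma> by (simp add: vec_eq_iff forall_2 matrix_matrix_mult_def sum_2 field_simps)
  then show ?thesis
    using lambda_fast_neq_slow
    by (simp add: slow_proj_def Let_def s_def f_def matrix_scalar_ac flip: scalar_matrix_assoc)
qed

lemma slow_proj_vec:
  "slow_proj a \<sigma> \<delta> *v vec_slow a \<sigma> \<delta> = vec_slow a \<sigma> \<delta>"
  "slow_proj a \<sigma> \<delta> *v vec_fast a \<sigma> \<delta> = 0"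
proof -
  define s f where "s = lambda_slow a \<sigma> \<delta>" and "f = lambda_fast a \<sigma> \<delta>"
  let ?X = "vector [vector [- f, \<sigma>], vector [- s * f / \<sigma>, s]] :: real^2^2"
  have "?X *v vector [1, s / \<sigma>] = (s - f) *\<^sub>R vector [1, s / \<sigma>]" "?X *v vector [1, f / \<sigma>] = 0"
    using \<sigma> by (simp_all add: vec_eq_iff forall_2 matrix_vector_mult_def sum_2 field_simps)
  then show "slow_proj a \<sigma> \<delta> *v vec_slow a \<sigma> \<delta> = vec_slow a \<sigma> \<delta>"
    "slow_proj a \<sigma> \<delta> *v vec_fast a \<sigma> \<delta> = 0"
    using lambda_fast_neq_slow
    by (simp_all add: slow_proj_def Let_def vec_slow_def vec_fast_def s_def f_def
        flip: scaleR_matrix_vector_assoc)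
qed

lemma coupled_mat_spectral:
  "coupled_mat a \<sigma> \<delta> = spectral (slow_proj a \<sigma> \<delta>) (lambda_slow a \<sigma> \<delta>) (lambda_fast a \<sigma> \<delta>)"
proof -
  define s f where "s = lambda_slow a \<sigma> \<delta>" and "f = lambda_fast a \<sigma> \<delta>"
  have "- a * \<sigma> / \<delta> = - s * f / \<sigma>" "- 1 / \<delta> = s + f"
    using lambda_mult lambda_sum \<sigma> by (simp_all add: s_def f_def power2_eq_square)
  then have "coupled_mat a \<sigma> \<delta> = vector [vector [0, \<sigma>], vector [- s * f / \<sigma>, s + f]]"
    unfolding coupled_mat_def by simp
  moreover have "s - f \<noteq> 0" using lambda_fast_neq_slow by (simp add: s_def f_def)
  ultimately show ?thesis
    unfolding spectral_def slow_proj_def Let_def s_def[symmetric] f_def[symmetric]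
    by (simp add: vec_eq_iff forall_2 mat_def)
qed

section \<open>Both solutions and their difference in the eigenbasis\<close>

lemma num_sol_modes:
  assumes "C > 0" "\<Delta>t > 0"
  shows "num_sol C a \<sigma> \<delta> \<Delta>t (bs *\<^sub>R vec_slow a \<sigma> \<delta> + bf *\<^sub>R vec_fast a \<sigma> \<delta>) n
    = (bs * R C (\<Delta>t * lambda_slow a \<sigma> \<delta>) ^ n) *\<^sub>R vec_slow a \<sigma> \<delta>
    + (bf * R C (\<Delta>t * lambda_fast a \<sigma> \<delta>) ^ n) *\<^sub>R vec_fast a \<sigma> \<delta>"
proof -
  have "\<Delta>t * lambda_slow a \<sigma> \<delta> \<le> 0" "\<Delta>t * lambda_fast a \<sigma> \<delta> \<le> 0"
    using assms lambda_slow_bounds lambda_fast_bounds by (simp_all add: mult_nonneg_nonpos)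
  then show ?thesis
    using assms
    by (simp add: num_sol_def coupled_mat_spectral spectral_scaleR spectral_R spectral_pow slow_proj_idem
        matrix_vector_right_distrib matrix_scaleR_vector_ac spectral_mult_vec slow_proj_vec
        matrix_vector_mult_scaleR)
qed

lemma exact_sol_modes:
  "exact_sol a \<sigma> \<delta> (bs *\<^sub>R vec_slow a \<sigma> \<delta> + bf *\<^sub>R vec_fast a \<sigma> \<delta>) t
    = (bs * exp (t * lambda_slow a \<sigma> \<delta>)) *\<^sub>R vec_slow a \<sigma> \<delta>
    + (bf * exp (t * lambda_fast a \<sigma> \<delta>)) *\<^sub>R vec_fast a \<sigma> \<delta>"
  by (simp add: exact_sol_def coupled_mat_spectral spectral_scaleR spectral_exp slow_proj_idem
      matrix_vector_right_distrib spectral_mult_vec slow_proj_vec matrix_vector_mult_scaleR)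

text \<open>The fast coefficient times \<open>f - s\<close> must equal
  \<open>- a * \<sigma>\<^sup>2 * u - s * u\<close>, which the characteristic equation turns into
  \<open>\<delta> * s^2 * u\<close>. Thus the data match the slow eigenvector up to order
  \<delta>.\<close>

lemma prepared_data_modes:
  "prepared_data a \<sigma> u = (u - prepared_fast a \<sigma> \<delta> u) *\<^sub>R vec_slow a \<sigma> \<delta>
     + prepared_fast a \<sigma> \<delta> u *\<^sub>R vec_fast a \<sigma> \<delta>"
proof -
  define s f where "s = lambda_slow a \<sigma> \<delta>" and "f = lambda_fast a \<sigma> \<delta>"
  have sf: "f - s \<noteq> 0" using lambda_fast_neq_slow by (simp add: s_def f_def)
  have "f = - 1 / \<delta> - s" "s * f = a * \<sigma>\<^sup>2 / \<delta>"
    using lambda_mult lambda_sum by (simp_all add: s_def f_def)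
  then have "s * (- 1 / \<delta> - s) = a * \<sigma>\<^sup>2 / \<delta>" by simp
  then have quad: "\<delta> * s^2 = - a * \<sigma>\<^sup>2 - s"
    using \<delta> by (simp add: field_simps power2_eq_square)
  define b where "b = prepared_fast a \<sigma> \<delta> u"
  have "b * (f - s) = \<delta> * s^2 * u" using sf by (simp add: b_def prepared_fast_def s_def f_def)
  then have "(u - b) * s + b * f = - a * \<sigma>\<^sup>2 * u" unfolding quad by (simp add: algebra_simps)
  then have "- a * \<sigma> * u = (u - b) * (s / \<sigma>) + b * (f / \<sigma>)"
    using \<sigma> by (simp add: field_simps power2_eq_square)
  then show ?thesis
    by (simp add: prepared_data_def vec_slow_def vec_fast_def vec_eq_iff forall_2 s_def f_def b_def)
qed

text \<open>Uniqueness of the mode decomposition resolves the definite description.\<close>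

lemma fast_coeff_prepared: "fast_coeff a \<sigma> \<delta> (prepared_data a \<sigma> u) = prepared_fast a \<sigma> \<delta> u"
proof -
  have "mode_coeffs a \<sigma> \<delta> (prepared_data a \<sigma> u) = (u - prepared_fast a \<sigma> \<delta> u, prepared_fast a \<sigma> \<delta> u)"
    unfolding mode_coeffs_def
    by (rule the1_equality[OF mode_decomposition_ex1[OF \<delta> \<sigma> disc]]) (simp add: prepared_data_modes[of u])
  then show ?thesis by (simp add: fast_coeff_def)
qed

lemma error_components:
  fixes u :: real
  assumes "C > 0" "\<Delta>t > 0"
  defines "es n \<equiv> R C (\<Delta>t * lambda_slow a \<sigma> \<delta>) ^ n - exp (real n * (\<Delta>t * lambda_slow a \<sigma> \<delta>))"
    and "ef n \<equiv> R C (\<Delta>t * lambda_fast a \<sigma> \<delta>) ^ n - exp (real n * (\<Delta>t * lambda_fast a \<sigma> \<delta>))"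
    and "bf \<equiv> prepared_fast a \<sigma> \<delta> u"
    and "err n \<equiv> num_sol C a \<sigma> \<delta> \<Delta>t (prepared_data a \<sigma> u) n
        - exact_sol a \<sigma> \<delta> (prepared_data a \<sigma> u) (real n * \<Delta>t)"
  shows "err n $ 1 = (u - bf) * es n + bf * ef n"
    and "err n $ 2 = (u - bf) * (lambda_slow a \<sigma> \<delta> / \<sigma>) * es n + lambda_fast a \<sigma> \<delta> / \<sigma> * bf * ef n"
  unfolding err_def prepared_data_modes num_sol_modes[OF assms(1,2)] exact_sol_modes es_def ef_def bf_def
  by (simp_all add: vec_slow_def vec_fast_def algebra_simps)

end

section \<open>Error bounds\<close>

lemma finite_time_steps:
  assumes "\<Delta>t > 0"
  shows "finite (time_steps T \<Delta>t)"
proof (rule finite_subset)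
  show "time_steps T \<Delta>t \<subseteq> {..nat \<lfloor>T / \<Delta>t\<rfloor>}"
    using assms by (auto simp: time_steps_def le_nat_floor pos_le_divide_eq)
qed simp

lemma zero_in_time_steps: "T > 0 \<Longrightarrow> 0 \<in> time_steps T \<Delta>t"
  by (simp add: time_steps_def)

lemma disc_mono:
  fixes a \<sigma> \<delta> \<delta>\<^sub>0 :: real
  assumes "a > 0" "\<delta> \<le> \<delta>\<^sub>0" "4 * a * \<delta>\<^sub>0 * \<sigma>\<^sup>2 < 1"
  shows "4 * a * \<delta> * \<sigma>\<^sup>2 < 1"
proof -
  have "4 * a * \<delta> * \<sigma>\<^sup>2 \<le> 4 * a * \<delta>\<^sub>0 * \<sigma>\<^sup>2"
    using assms by (intro mult_right_mono mult_left_mono) auto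
  then show ?thesis using assms by linarith
qed

text \<open>One factor \<delta> is explicit in the fast coefficient, the other comes from the
  eigenvalue gap of order 1/\<delta>. Multiplying by the fast eigenvalue costs one of them.\<close>

lemma prepared_fast_bounds:
  assumes "a > 0" "\<sigma> > 0" "0 < \<delta>" "\<delta> \<le> \<delta>\<^sub>0" "4 * a * \<delta>\<^sub>0 * \<sigma>\<^sup>2 < 1"
  defines "K \<equiv> (2 * a * \<sigma>\<^sup>2)\<^sup>2 / sqrt (1 - 4 * a * \<delta>\<^sub>0 * \<sigma>\<^sup>2)"
  shows "\<bar>prepared_fast a \<sigma> \<delta> u\<bar> \<le> K * \<delta>\<^sup>2 * \<bar>u\<bar>"
    and "\<bar>lambda_fast a \<sigma> \<delta> / \<sigma> * prepared_fast a \<sigma> \<delta> u\<bar> \<le> K / \<sigma> * \<delta> * \<bar>u\<bar>"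
proof -
  have le: "4 * a * \<delta> * \<sigma>\<^sup>2 \<le> 4 * a * \<delta>\<^sub>0 * \<sigma>\<^sup>2"
    using assms by (intro mult_right_mono mult_left_mono) auto
  have disc: "4 * a * \<delta> * \<sigma>\<^sup>2 < 1" using le assms by linarith
  note ctx = assms(1-3) disc
  define s f D where "s = lambda_slow a \<sigma> \<delta>" and "f = lambda_fast a \<sigma> \<delta>"
    and "D = sqrt (1 - 4 * a * \<delta> * \<sigma>\<^sup>2)"
  define D0 where "D0 = sqrt (1 - 4 * a * \<delta>\<^sub>0 * \<sigma>\<^sup>2)"
  \<comment> \<open>Uniformity in \<delta>: the root of the discriminant is smallest at
    \<open>\<delta>\<^sub>0\<close> and still positive there.\<close>
  have D0: "0 < D0" "D0 \<le> D"
    unfolding D_def D0_def using assms le by simp_all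
  have K: "K = (2 * a * \<sigma>\<^sup>2)\<^sup>2 / D0" "K \<ge> 0" using D0 by (simp_all add: K_def D0_def)
  have "s\<^sup>2 \<le> (2 * a * \<sigma>\<^sup>2)\<^sup>2"
    using lambda_slow_bounds(2)[OF ctx] by (simp add: s_def abs_le_square_iff[symmetric] assms)
  then have "s\<^sup>2 / D \<le> K" unfolding K using D0 by (intro frac_le) auto
  then have "s\<^sup>2 / D * (\<delta>\<^sup>2 * \<bar>u\<bar>) \<le> K * (\<delta>\<^sup>2 * \<bar>u\<bar>)" by (intro mult_right_mono) auto
  moreover have "\<bar>prepared_fast a \<sigma> \<delta> u\<bar> = s\<^sup>2 / D * (\<delta>\<^sup>2 * \<bar>u\<bar>)"
  proof -
    have "prepared_fast a \<sigma> \<delta> u = - (s\<^sup>2 / D * (\<delta>\<^sup>2 * u))"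
      unfolding prepared_fast_def lambda_diff[OF ctx]
      by (simp add: s_def D_def power2_eq_square)
    then show ?thesis using D0 by (simp add: abs_mult)
  qed
  ultimately show 1: "\<bar>prepared_fast a \<sigma> \<delta> u\<bar> \<le> K * \<delta>\<^sup>2 * \<bar>u\<bar>" by simp
  have "\<bar>f\<bar> * \<bar>prepared_fast a \<sigma> \<delta> u\<bar> \<le> 1 / \<delta> * (K * \<delta>\<^sup>2 * \<bar>u\<bar>)"
    using lambda_fast_bounds(2)[OF ctx] 1 assms by (intro mult_mono) (auto simp: f_def)
  also have "\<dots> = K * \<delta> * \<bar>u\<bar>" using assms by (simp add: power2_eq_square)
  finally have "\<bar>f\<bar> * \<bar>prepared_fast a \<sigma> \<delta> u\<bar> / \<sigma> \<le> K * \<delta> * \<bar>u\<bar> / \<sigma>"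
    using assms by (intro divide_right_mono) auto
  then show "\<bar>lambda_fast a \<sigma> \<delta> / \<sigma> * prepared_fast a \<sigma> \<delta> u\<bar> \<le> K / \<sigma> * \<delta> * \<bar>u\<bar>"
    using assms by (simp add: abs_mult f_def)
qed

lemma slow_error_le:
  assumes C: "1/60 < C" "C < 1/20" and par: "a > 0" "\<sigma> > 0" "\<delta> > 0" "4 * a * \<delta> * \<sigma>\<^sup>2 < 1"
    and dt: "\<Delta>t > 0"
  shows "\<bar>R C (\<Delta>t * lambda_slow a \<sigma> \<delta>) ^ n - exp (real n * (\<Delta>t * lambda_slow a \<sigma> \<delta>))\<bar>
    \<le> 3 * (2 * a * \<sigma>\<^sup>2)^4 * \<Delta>t^4"
proof -
  have z: "\<Delta>t * lambda_slow a \<sigma> \<delta> \<le> 0"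
    using lambda_slow_bounds(1)[OF par] dt by (simp add: mult_nonneg_nonpos)
  have "\<bar>\<Delta>t * lambda_slow a \<sigma> \<delta>\<bar>^4 \<le> (\<Delta>t * (2 * a * \<sigma>\<^sup>2))^4"
    using lambda_slow_bounds(2)[OF par] dt by (intro power_mono) (auto simp: abs_mult)
  then show ?thesis using R_power_minus_exp_le[OF C z, of 4 n] by (simp add: power_mult_distrib mult_ac)
qed

lemma fast_error_le:
  assumes C: "1/60 < C" "C < 1/20" and par: "a > 0" "\<sigma> > 0" "\<delta> > 0" "4 * a * \<delta> * \<sigma>\<^sup>2 < 1"
    and dt: "\<Delta>t > 0" and k: "k \<le> 4"
  shows "\<bar>R C (\<Delta>t * lambda_fast a \<sigma> \<delta>) ^ n - exp (real n * (\<Delta>t * lambda_fast a \<sigma> \<delta>))\<bar>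
    \<le> 3 * (\<Delta>t / \<delta>)^k"
proof -
  have z: "\<Delta>t * lambda_fast a \<sigma> \<delta> \<le> 0"
    using lambda_fast_bounds(1)[OF par] dt by (simp add: mult_nonneg_nonpos)
  have "\<bar>\<Delta>t * lambda_fast a \<sigma> \<delta>\<bar> \<le> \<Delta>t * (1 / \<delta>)"
    using lambda_fast_bounds(2)[OF par] dt unfolding abs_mult by (intro mult_mono) auto
  then have "\<bar>\<Delta>t * lambda_fast a \<sigma> \<delta>\<bar>^k \<le> (\<Delta>t / \<delta>)^k"
    by (intro power_mono) auto
  then show ?thesis using R_power_minus_exp_le[OF C z k, of n] by linarith
qed

lemma max_err_upper:
  fixes u :: real
  assumes C: "1/60 < C" "C < 1/20" and T: "T > 0"
    and par: "a > 0" "\<sigma> > 0" "4 * a * \<delta>\<^sub>0 * \<sigma>\<^sup>2 < 1"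
  obtains K where "\<And>\<delta> \<Delta>t. 0 < \<delta> \<Longrightarrow> \<delta> \<le> \<delta>\<^sub>0 \<Longrightarrow> 0 < \<Delta>t \<Longrightarrow>
      max_err C a \<sigma> T \<delta> \<Delta>t (prepared_data a \<sigma> u) \<le> K * (\<Delta>t + \<Delta>t^4) \<and>
      max_err_u C a \<sigma> T \<delta> \<Delta>t (prepared_data a \<sigma> u) \<le> K * (\<Delta>t\<^sup>2 + \<Delta>t^4)"
proof -
  define L where "L = 2 * a * \<sigma>\<^sup>2"
  define M where "M = L\<^sup>2 / sqrt (1 - 4 * a * \<delta>\<^sub>0 * \<sigma>\<^sup>2)"
  define A where "A = (1 + M * \<delta>\<^sub>0\<^sup>2) * \<bar>u\<bar> * (3 * L^4)"
  define B where "B = 3 * M * \<bar>u\<bar>"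
  \<comment> \<open>The sum of all constants below, so that it dominates each coefficient in both
    estimates.\<close>
  define K where "K = A + A * L / \<sigma> + B + B * \<delta>\<^sub>0 + B / \<sigma>"
  have L: "L \<ge> 0" using par by (simp add: L_def)
  have M: "M \<ge> 0" using par by (simp add: M_def)
  have A: "A \<ge> 0" and B: "B \<ge> 0" using M by (simp_all add: A_def B_def)
  show thesis
  proof (rule that[of K])
    fix \<delta> \<Delta>t :: real
    assume \<delta>: "0 < \<delta>" "\<delta> \<le> \<delta>\<^sub>0" and dt: "0 < \<Delta>t"
    have disc: "4 * a * \<delta> * \<sigma>\<^sup>2 < 1" using disc_mono par \<delta> by blast
    note ctx = par(1,2) \<delta>(1) disc
    define s f bf where "s = lambda_slow a \<sigma> \<delta>" and "f = lambda_fast a \<sigma> \<delta>"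
      and "bf = prepared_fast a \<sigma> \<delta> u"
    define err where "err n = num_sol C a \<sigma> \<delta> \<Delta>t (prepared_data a \<sigma> u) n
        - exact_sol a \<sigma> \<delta> (prepared_data a \<sigma> u) (real n * \<Delta>t)" for n
    define es where "es n = R C (\<Delta>t * s) ^ n - exp (real n * (\<Delta>t * s))" for n
    define ef where "ef n = R C (\<Delta>t * f) ^ n - exp (real n * (\<Delta>t * f))" for n
    have comp: "err n $ 1 = (u - bf) * es n + bf * ef n"
      "err n $ 2 = (u - bf) * (s / \<sigma>) * es n + f / \<sigma> * bf * ef n" for n
      unfolding err_def es_def ef_def s_def f_def bf_def
      using C dt by (subst error_components[OF ctx]; simp)+
    have bf: "\<bar>bf\<bar> \<le> M * \<delta>\<^sup>2 * \<bar>u\<bar>" "\<bar>f / \<sigma> * bf\<bar> \<le> M / \<sigma> * \<delta> * \<bar>u\<bar>"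
      using prepared_fast_bounds[OF par(1,2) \<delta> par(3), of u] by (simp_all add: bf_def f_def M_def L_def)
    have es: "\<bar>es n\<bar> \<le> 3 * L^4 * \<Delta>t^4" for n
      using slow_error_le[OF C ctx dt, of n] by (simp add: es_def s_def L_def)
    have ef: "\<bar>ef n\<bar> \<le> 3 * (\<Delta>t / \<delta>)^k" if "k \<le> 4" for n k
      using fast_error_le[OF C ctx dt that, of n] by (simp add: ef_def f_def)
    have slow: "\<bar>(u - bf) * es n\<bar> \<le> A * \<Delta>t^4" for n
    proof -
      have "M * \<delta>\<^sup>2 * \<bar>u\<bar> \<le> M * \<delta>\<^sub>0\<^sup>2 * \<bar>u\<bar>"
        using \<delta> M by (intro mult_right_mono mult_left_mono power_mono) auto
      then have "\<bar>u - bf\<bar> \<le> (1 + M * \<delta>\<^sub>0\<^sup>2) * \<bar>u\<bar>" using bf(1) by (simp add: algebra_simps)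
      then have "\<bar>u - bf\<bar> * \<bar>es n\<bar> \<le> (1 + M * \<delta>\<^sub>0\<^sup>2) * \<bar>u\<bar> * (3 * L^4 * \<Delta>t^4)"
        using es M by (intro mult_mono) auto
      then show ?thesis by (simp add: A_def abs_mult mult_ac)
    qed
    have slow2: "\<bar>(u - bf) * (s / \<sigma>) * es n\<bar> \<le> A * L / \<sigma> * \<Delta>t^4" for n
    proof -
      have "\<bar>s / \<sigma>\<bar> \<le> L / \<sigma>" using lambda_slow_bounds(2)[OF ctx] par by (simp add: s_def L_def divide_right_mono)
      then have "\<bar>(u - bf) * es n\<bar> * \<bar>s / \<sigma>\<bar> \<le> A * \<Delta>t^4 * (L / \<sigma>)"
        using slow A by (intro mult_mono) auto
      then show ?thesis by (simp add: abs_mult mult_ac)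
    qed
    \<comment> \<open>With exponent 2 the square of \<delta> in the coefficient cancels
      exactly.\<close>
    have fast: "\<bar>bf * ef n\<bar> \<le> B * \<Delta>t\<^sup>2" for n
    proof -
      have "\<bar>bf\<bar> * \<bar>ef n\<bar> \<le> M * \<delta>\<^sup>2 * \<bar>u\<bar> * (3 * (\<Delta>t / \<delta>)\<^sup>2)"
        using bf(1) ef[of 2] M by (intro mult_mono) auto
      then show ?thesis using \<delta> by (simp add: B_def abs_mult power_divide mult_ac)
    qed
    \<comment> \<open>The same term to first order, in the form used for the norm; exponent 1 leaves
      one \<delta>, bounded by \<open>\<delta>\<^sub>0\<close>.\<close>
    have fast1: "\<bar>bf * ef n\<bar> \<le> B * \<delta>\<^sub>0 * \<Delta>t" for n
    proof -
      have "\<bar>bf\<bar> * \<bar>ef n\<bar> \<le> M * \<delta>\<^sup>2 * \<bar>u\<bar> * (3 * (\<Delta>t / \<delta>)^1)"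
        using bf(1) ef[of 1] M by (intro mult_mono) auto
      also have "\<dots> = B * \<Delta>t * \<delta>" using \<delta> by (simp add: B_def power2_eq_square)
      also have "\<dots> \<le> B * \<Delta>t * \<delta>\<^sub>0" using \<delta> B dt by (intro mult_left_mono) auto
      finally show ?thesis by (simp add: abs_mult mult_ac)
    qed
    have fast2: "\<bar>f / \<sigma> * bf * ef n\<bar> \<le> B / \<sigma> * \<Delta>t" for n
    proof -
      have "\<bar>f / \<sigma> * bf\<bar> * \<bar>ef n\<bar> \<le> M / \<sigma> * \<delta> * \<bar>u\<bar> * (3 * (\<Delta>t / \<delta>)^1)"
        using bf(2) ef[of 1] M \<delta> par by (intro mult_mono) auto
      also have "\<dots> = B / \<sigma> * \<Delta>t" using \<delta> by (simp add: B_def)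
      finally show ?thesis by (simp add: abs_mult)
    qed
    have err1: "\<bar>err n $ 1\<bar> \<le> K * (\<Delta>t\<^sup>2 + \<Delta>t^4)" for n
    proof -
      have "\<bar>err n $ 1\<bar> \<le> A * \<Delta>t^4 + B * \<Delta>t\<^sup>2"
        unfolding comp using slow[of n] fast[of n] by linarith
      also have "\<dots> \<le> K * \<Delta>t^4 + K * \<Delta>t\<^sup>2"
        using A B L par \<delta> by (intro add_mono mult_right_mono) (auto simp: K_def)
      finally show ?thesis by (simp add: algebra_simps)
    qed
    have err: "norm (err n) \<le> K * (\<Delta>t + \<Delta>t^4)" for n
    proof -
      have "norm (err n) \<le> \<bar>err n $ 1\<bar> + \<bar>err n $ 2\<bar>"
        using norm_le_l1_cart[of "err n"] by (simp add: sum_2)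
      also have "\<dots> \<le> (A * \<Delta>t^4 + B * \<delta>\<^sub>0 * \<Delta>t) + (A * L / \<sigma> * \<Delta>t^4 + B / \<sigma> * \<Delta>t)"
        unfolding comp using slow[of n] fast1[of n] slow2[of n] fast2[of n] by linarith
      also have "\<dots> = (A + A * L / \<sigma>) * \<Delta>t^4 + (B * \<delta>\<^sub>0 + B / \<sigma>) * \<Delta>t" by (simp add: algebra_simps)
      also have "\<dots> \<le> K * \<Delta>t^4 + K * \<Delta>t"
        using A B L par \<delta> dt by (intro add_mono mult_right_mono) (auto simp: K_def)
      finally show ?thesis by (simp add: algebra_simps)
    qed
    have "time_steps T \<Delta>t \<noteq> {}" using zero_in_time_steps[OF T] by blast
    then show "max_err C a \<sigma> T \<delta> \<Delta>t (prepared_data a \<sigma> u) \<le> K * (\<Delta>t + \<Delta>t^4) \<and>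
      max_err_u C a \<sigma> T \<delta> \<Delta>t (prepared_data a \<sigma> u) \<le> K * (\<Delta>t\<^sup>2 + \<Delta>t^4)"
      using err err1 finite_time_steps[OF dt, of T] unfolding max_err_def max_err_u_def
      by (auto simp: err_def)
  qed
qed

section \<open>Sharpness along the transition sequence\<close>

lemma isCont_R:
  assumes "C > 0" "z \<le> 0"
  shows "isCont (R C) z"
proof -
  have "1 - z/4 + z\<^sup>2/48 \<noteq> 0" "1 - coeff_a2 C * z + 3/2 * C * z\<^sup>2 \<noteq> 0"
    using H_den_pos[of z] R_den1_pos[OF assms] by auto
  then show ?thesis
    unfolding R_def[abs_def] H_def by (intro continuous_intros) auto
qed

lemma abs_divide_power_le:
  fixes t :: real
  assumes "\<bar>x\<bar> \<le> c * t^(k + m)" "t > 0"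
  shows "\<bar>x / t^k\<bar> \<le> c * t^m"
  using assms by (simp add: abs_divide pos_divide_le_eq power_add mult_ac)

lemma tendsto_bounded_below:
  fixes e :: "real \<Rightarrow> real"
  assumes "((\<lambda>t. e t / t^k) \<longlongrightarrow> L) (at_right 0)" "L \<noteq> 0"
  shows "\<forall>\<^sub>F t in at_right 0. \<bar>L\<bar> / 2 * t^k \<le> \<bar>e t\<bar>"
proof -
  have "\<forall>\<^sub>F t in at_right 0. \<bar>e t / t^k\<bar> > \<bar>L\<bar> / 2"
    using assms by (intro order_tendstoD(1)[OF tendsto_rabs]) auto
  moreover have "\<forall>\<^sub>F t in at_right (0::real). t > 0" by (rule eventually_at_right_less)
  ultimately show ?thesis
    by eventually_elim (auto simp: abs_divide power_abs pos_less_divide_eq)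
qed

text \<open>One step suffices: along \<open>\<delta> = \<kappa> \<Delta>t\<close> the argument \<open>\<Delta>t \<lambda>\<^sub>f\<close> tends to \<open>-1/\<kappa>\<close>, the fast
  coefficient is of exact order \<open>\<Delta>t\<^sup>2\<close>, and the slow part of the one-step error is of higher
  order.\<close>

lemma max_err_lower:
  fixes u :: real
  assumes C: "1/60 < C" "C < 1/20" and T: "T > 0" and par: "a > 0" "\<sigma> > 0"
    and u: "u \<noteq> 0" and \<kappa>: "\<kappa> > 0" and gen: "R C (- 1 / \<kappa>) \<noteq> exp (- 1 / \<kappa>)"
  shows "\<exists>c>0. \<forall>\<^sub>F \<Delta>t in at_right 0.
      c * \<Delta>t \<le> max_err C a \<sigma> T (\<kappa> * \<Delta>t) \<Delta>t (prepared_data a \<sigma> u)"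
    and "\<exists>c>0. \<forall>\<^sub>F \<Delta>t in at_right 0.
      c * \<Delta>t\<^sup>2 \<le> max_err_u C a \<sigma> T (\<kappa> * \<Delta>t) \<Delta>t (prepared_data a \<sigma> u)"
proof -
  define err where "err t = num_sol C a \<sigma> (\<kappa> * t) t (prepared_data a \<sigma> u) 1
      - exact_sol a \<sigma> (\<kappa> * t) (prepared_data a \<sigma> u) (real 1 * t)" for t
  define s where "s t = lambda_slow a \<sigma> (\<kappa> * t)" for t
  define es where "es t = R C (t * s t) - exp (t * s t)" for t
  define D where "D t = sqrt (1 - 4 * a * (\<kappa> * t) * \<sigma>\<^sup>2)" for t
  \<comment> \<open>For \<open>\<delta> = \<kappa> * t\<close> the fast coefficient is
    \<open>t\<^sup>2 * g t\<close>, and \<open>h t\<close> is \<open>t\<close> times the fast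
    eigenvalue. Both \<open>g\<close> and \<open>h\<close> depend on \<open>t\<close> only through
    \<open>D t\<close>, which tends to 1.\<close>
  define g where "g t = - (\<kappa>\<^sup>2 * (- 2 * a * \<sigma>\<^sup>2 / (1 + D t))\<^sup>2 / D t * u)" for t
  define h where "h t = (- 1 - D t) / (2 * \<kappa>)" for t
  define e where "e t = R C (h t) - exp (h t)" for t
  define L where "L = 2 * a * \<sigma>\<^sup>2"
  define \<epsilon> where "\<epsilon> = R C (- 1 / \<kappa>) - exp (- 1 / \<kappa>)"
  define G where "G = - (\<kappa>\<^sup>2 * (- a * \<sigma>\<^sup>2)\<^sup>2 * u)"
  let ?F = "at_right (0::real)"

  have small: "\<forall>\<^sub>F t in ?F. 0 < t \<and> t < d" if "d > 0" for d
    using that by (simp add: eventually_at_right_less eventually_conj_iff eventually_at_right_field) blast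
  have good: "\<forall>\<^sub>F t in ?F. 0 < t \<and> t \<le> T \<and> 4 * a * (\<kappa> * t) * \<sigma>\<^sup>2 < 1"
  proof -
    have p: "4 * a * \<kappa> * \<sigma>\<^sup>2 > 0" using par \<kappa> by simp
    show ?thesis
      using small[OF T] small[OF divide_pos_pos[OF zero_less_one p]]
    proof eventually_elim
      case (elim t)
      then have "t * (4 * a * \<kappa> * \<sigma>\<^sup>2) < 1" using p by (simp add: pos_less_divide_eq)
      then show ?case using elim by (simp add: mult_ac)
    qed
  qed

  have "((\<lambda>t. sqrt (1 - 4 * a * (\<kappa> * t) * \<sigma>\<^sup>2)) \<longlongrightarrow> sqrt (1 - 4 * a * (\<kappa> * 0) * \<sigma>\<^sup>2)) ?F"
    by (intro tendsto_intros)
  then have D: "(D \<longlongrightarrow> 1) ?F" by (simp add: D_def[abs_def])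
  have "(g \<longlongrightarrow> - (\<kappa>\<^sup>2 * (- 2 * a * \<sigma>\<^sup>2 / (1 + 1))\<^sup>2 / 1 * u)) ?F"
    unfolding g_def[abs_def] by (intro tendsto_intros D) auto
  then have g: "(g \<longlongrightarrow> G) ?F" by (simp add: G_def)
  have "(h \<longlongrightarrow> (- 1 - 1) / (2 * \<kappa>)) ?F"
    unfolding h_def[abs_def] using \<kappa> by (intro tendsto_intros D) auto
  then have h: "(h \<longlongrightarrow> - 1 / \<kappa>) ?F" by simp
  have e: "(e \<longlongrightarrow> \<epsilon>) ?F"
    unfolding e_def[abs_def] \<epsilon>_def using C \<kappa>
    by (intro tendsto_intros h isCont_tendsto_compose[OF isCont_R]) auto

  \<comment> \<open>The fast eigenvalue is \<open>h t / t\<close>, so the second component is one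
    order larger than the first. After scaling, the fast terms keep a limit while the slow ones are
    of order \<open>t\<^sup>2\<close> and \<open>t^3\<close>.\<close>
  have comps: "\<forall>\<^sub>F t in ?F.
      err t $ 1 / t^2 = (u - t\<^sup>2 * g t) * (es t / t\<^sup>2) + g t * e t \<and>
      err t $ 2 / t^1 = (u - t\<^sup>2 * g t) * (s t / \<sigma> * es t / t) + h t / \<sigma> * g t * e t \<and>
      \<bar>es t / t\<^sup>2\<bar> \<le> 3 * L^4 * t\<^sup>2 \<and> \<bar>s t / \<sigma> * es t / t\<bar> \<le> L / \<sigma> * (3 * L^4) * t^3"
    using good
  proof eventually_elim
    case (elim t)
    then have t: "t > 0" and disc: "4 * a * (\<kappa> * t) * \<sigma>\<^sup>2 < 1" by auto
    have \<delta>: "\<kappa> * t > 0" using \<kappa> t by simp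
    note ctx = par \<delta> disc
    have f: "lambda_fast a \<sigma> (\<kappa> * t) = h t / t"
      using t by (simp add: lambda_fast_def h_def D_def)
    have bf: "prepared_fast a \<sigma> (\<kappa> * t) u = t\<^sup>2 * g t"
      unfolding prepared_fast_def lambda_diff[OF ctx]
      unfolding lambda_slow_eq[OF ctx] g_def D_def
      using t \<kappa> by (simp add: power2_eq_square)
    have "C > 0" using C by simp
    note comp = error_components[OF ctx this t, of u 1, folded err_def, unfolded f bf]
    have es: "\<bar>es t\<bar> \<le> 3 * L^4 * t^4"
      using slow_error_le[OF C ctx t, of 1] by (simp add: es_def s_def L_def)
    have s: "\<bar>s t / \<sigma>\<bar> \<le> L / \<sigma>"
      using lambda_slow_bounds(2)[OF ctx] par by (simp add: s_def L_def divide_right_mono)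
    have "L \<ge> 0" using par by (simp add: L_def)
    then have "\<bar>s t / \<sigma> * es t\<bar> \<le> L / \<sigma> * (3 * L^4 * t^4)"
      unfolding abs_mult using s es par by (intro mult_mono) auto
    then have "\<bar>s t / \<sigma> * es t\<bar> \<le> L / \<sigma> * (3 * L^4) * t^(1 + 3)"
      by (simp only: mult.assoc) simp
    from abs_divide_power_le[OF this t]
    have "\<bar>s t / \<sigma> * es t / t\<bar> \<le> L / \<sigma> * (3 * L^4) * t^3"
      by (simp only: power_one_right)
    moreover have "\<bar>es t\<bar> \<le> 3 * L^4 * t^(2 + 2)" using es by (simp only: numeral_Bit0)
    then have "\<bar>es t / t\<^sup>2\<bar> \<le> 3 * L^4 * t\<^sup>2" using t by (rule abs_divide_power_le)
    moreover have "err t $ 1 = (u - t\<^sup>2 * g t) * es t + t\<^sup>2 * g t * e t"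
      using comp(1) t by (simp add: es_def e_def s_def)
    then have "err t $ 1 / t^2 = (u - t\<^sup>2 * g t) * (es t / t\<^sup>2) + g t * e t"
      using t by (simp add: add_divide_distrib)
    moreover have "err t $ 2 = (u - t\<^sup>2 * g t) * (s t / \<sigma>) * es t + h t / t / \<sigma> * (t\<^sup>2 * g t) * e t"
      using comp(2) t by (simp add: es_def e_def s_def)
    then have "err t $ 2 / t^1 = (u - t\<^sup>2 * g t) * (s t / \<sigma> * es t / t) + h t / \<sigma> * g t * e t"
      using t by (simp add: add_divide_distrib power2_eq_square)
    ultimately show ?case by blast
  qed
  have z1: "((\<lambda>t. es t / t\<^sup>2) \<longlongrightarrow> 0) ?F"
  proof (rule Lim_null_comparison)
    show "\<forall>\<^sub>F t in ?F. norm (es t / t\<^sup>2) \<le> 3 * L^4 * t\<^sup>2" using comps by eventually_elim auto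
    have "((\<lambda>t. 3 * L^4 * t\<^sup>2) \<longlongrightarrow> 3 * L^4 * 0\<^sup>2) ?F" by (intro tendsto_intros)
    then show "((\<lambda>t. 3 * L^4 * t\<^sup>2) \<longlongrightarrow> 0) ?F" by simp
  qed
  have z2: "((\<lambda>t. s t / \<sigma> * es t / t) \<longlongrightarrow> 0) ?F"
  proof (rule Lim_null_comparison)
    show "\<forall>\<^sub>F t in ?F. norm (s t / \<sigma> * es t / t) \<le> L / \<sigma> * (3 * L^4) * t^3"
      using comps by eventually_elim auto
    have "((\<lambda>t. L / \<sigma> * (3 * L^4) * t^3) \<longlongrightarrow> L / \<sigma> * (3 * L^4) * 0^3) ?F"
      using par by (intro tendsto_intros) auto
    then show "((\<lambda>t. L / \<sigma> * (3 * L^4) * t^3) \<longlongrightarrow> 0) ?F" by simp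
  qed
  \<comment> \<open>Nonzero data and the mismatch of \<open>R C\<close> and \<open>exp\<close> at
    \<open>- 1 / \<kappa>\<close> make both limits nonzero.\<close>
  have G: "G * \<epsilon> \<noteq> 0" using par u \<kappa> gen by (simp add: G_def \<epsilon>_def)
  have "((\<lambda>t. (u - t\<^sup>2 * g t) * (es t / t\<^sup>2) + g t * e t) \<longlongrightarrow> (u - 0\<^sup>2 * G) * 0 + G * \<epsilon>) ?F"
    by (intro tendsto_intros z1 g e)
  then have lim1: "((\<lambda>t. err t $ 1 / t^2) \<longlongrightarrow> G * \<epsilon>) ?F"
    using comps by (auto elim!: Lim_transform_eventually eventually_mono)
  have "((\<lambda>t. (u - t\<^sup>2 * g t) * (s t / \<sigma> * es t / t) + h t / \<sigma> * g t * e t)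
      \<longlongrightarrow> (u - 0\<^sup>2 * G) * 0 + - 1 / \<kappa> / \<sigma> * G * \<epsilon>) ?F"
    using par by (intro tendsto_intros z2 g e h) auto
  then have lim2: "((\<lambda>t. err t $ 2 / t^1) \<longlongrightarrow> - 1 / \<kappa> / \<sigma> * G * \<epsilon>) ?F"
    using comps by (auto elim!: Lim_transform_eventually eventually_mono)
  have G2: "- 1 / \<kappa> / \<sigma> * G * \<epsilon> \<noteq> 0" using G \<kappa> par by simp

  \<comment> \<open>Once \<open>t \<le> T\<close> the first step is admissible, so its error bounds
    both maxima from below.\<close>
  have one: "1 \<in> time_steps T t" if "0 < t" "t \<le> T" for t
    using that by (simp add: time_steps_def)
  have max: "\<forall>\<^sub>F t in ?F. norm (err t) \<le> max_err C a \<sigma> T (\<kappa> * t) t (prepared_data a \<sigma> u) \<and>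
      \<bar>err t $ 1\<bar> \<le> max_err_u C a \<sigma> T (\<kappa> * t) t (prepared_data a \<sigma> u)"
    using good
  proof eventually_elim
    case (elim t)
    have "\<bar>err t $ 1\<bar> = \<bar>num_sol C a \<sigma> (\<kappa> * t) t (prepared_data a \<sigma> u) 1 $ 1
      - exact_sol a \<sigma> (\<kappa> * t) (prepared_data a \<sigma> u) (real 1 * t) $ 1\<bar>"
      by (simp add: err_def)
    then show ?case
      unfolding max_err_def max_err_u_def
      using elim finite_time_steps[of t T] one[of t]
      by (auto simp only: err_def intro!: Max_ge finite_imageI imageI)
  qed
  show "\<exists>c>0. \<forall>\<^sub>F \<Delta>t in at_right 0.
      c * \<Delta>t \<le> max_err C a \<sigma> T (\<kappa> * \<Delta>t) \<Delta>t (prepared_data a \<sigma> u)"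
  proof (intro exI conjI)
    show "\<bar>- 1 / \<kappa> / \<sigma> * G * \<epsilon>\<bar> / 2 > 0" using G2 by simp
    show "\<forall>\<^sub>F \<Delta>t in at_right 0. \<bar>- 1 / \<kappa> / \<sigma> * G * \<epsilon>\<bar> / 2 * \<Delta>t
        \<le> max_err C a \<sigma> T (\<kappa> * \<Delta>t) \<Delta>t (prepared_data a \<sigma> u)"
      using tendsto_bounded_below[OF lim2 G2] max
    proof eventually_elim
      case (elim t)
      then show ?case using component_le_norm_cart[of "err t" 2] by (simp only: power_one_right) linarith
    qed
  qed
  show "\<exists>c>0. \<forall>\<^sub>F \<Delta>t in at_right 0.
      c * \<Delta>t\<^sup>2 \<le> max_err_u C a \<sigma> T (\<kappa> * \<Delta>t) \<Delta>t (prepared_data a \<sigma> u)"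
  proof (intro exI conjI)
    show "\<bar>G * \<epsilon>\<bar> / 2 > 0" using G by simp
    show "\<forall>\<^sub>F \<Delta>t in at_right 0. \<bar>G * \<epsilon>\<bar> / 2 * \<Delta>t\<^sup>2
        \<le> max_err_u C a \<sigma> T (\<kappa> * \<Delta>t) \<Delta>t (prepared_data a \<sigma> u)"
      using tendsto_bounded_below[OF lim1 G] max by eventually_elim linarith
  qed
qed

theorem proposition6:
  fixes a \<sigma> \<delta>\<^sub>0 C T :: real
  assumes "a > 0" and "\<sigma> > 0" and "\<delta>\<^sub>0 > 0" and "4 * a * \<delta>\<^sub>0 * \<sigma>\<^sup>2 < 1"
    and "C \<in> {C_minus..C_plus}" and "T > 0"
  shows
    "(\<exists>K. \<forall>u\<^sub>0 \<delta>. 0 < \<delta> \<and> \<delta> \<le> \<delta>\<^sub>0 \<longrightarrow>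
        (let \<beta>\<^sub>f = fast_coeff a \<sigma> \<delta> (prepared_data a \<sigma> u\<^sub>0);
             l\<^sub>s = lambda_slow a \<sigma> \<delta>; l\<^sub>f = lambda_fast a \<sigma> \<delta>
         in \<beta>\<^sub>f = \<delta> * l\<^sub>s\<^sup>2 / (l\<^sub>f - l\<^sub>s) * u\<^sub>0
            \<and> \<bar>\<beta>\<^sub>f\<bar> \<le> K * \<delta>\<^sup>2 * \<bar>u\<^sub>0\<bar>
            \<and> \<bar>l\<^sub>f / \<sigma> * \<beta>\<^sub>f\<bar> \<le> K * \<delta> * \<bar>u\<^sub>0\<bar>))
     \<and> (\<forall>u\<^sub>0. \<exists>K. \<forall>\<delta> \<Delta>t. 0 < \<delta> \<and> \<delta> \<le> \<delta>\<^sub>0 \<and> 0 < \<Delta>t \<longrightarrow>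
          max_err C a \<sigma> T \<delta> \<Delta>t (prepared_data a \<sigma> u\<^sub>0) \<le> K * (\<Delta>t + \<Delta>t ^ 4)
          \<and> max_err_u C a \<sigma> T \<delta> \<Delta>t (prepared_data a \<sigma> u\<^sub>0) \<le> K * (\<Delta>t\<^sup>2 + \<Delta>t ^ 4))
     \<and> (\<forall>u\<^sub>0 \<kappa>. u\<^sub>0 \<noteq> 0 \<and> \<kappa> > 0 \<and> R C (- 1 / \<kappa>) \<noteq> exp (- 1 / \<kappa>) \<longrightarrow>
          (\<exists>c>0. \<forall>\<^sub>F \<Delta>t in at_right 0.
              c * \<Delta>t \<le> max_err C a \<sigma> T (\<kappa> * \<Delta>t) \<Delta>t (prepared_data a \<sigma> u\<^sub>0))
          \<and> (\<exists>c>0. \<forall>\<^sub>F \<Delta>t in at_right 0.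
              c * \<Delta>t\<^sup>2 \<le> max_err_u C a \<sigma> T (\<kappa> * \<Delta>t) \<Delta>t (prepared_data a \<sigma> u\<^sub>0)))"
proof (intro conjI)
  note C = C_bounds[OF assms(5)]
  define K where "K = (2 * a * \<sigma>\<^sup>2)\<^sup>2 / sqrt (1 - 4 * a * \<delta>\<^sub>0 * \<sigma>\<^sup>2)"
  have K: "K \<ge> 0" "K / \<sigma> \<ge> 0" using assms by (simp_all add: K_def)
  show "\<exists>K. \<forall>u\<^sub>0 \<delta>. 0 < \<delta> \<and> \<delta> \<le> \<delta>\<^sub>0 \<longrightarrow>
        (let \<beta>\<^sub>f = fast_coeff a \<sigma> \<delta> (prepared_data a \<sigma> u\<^sub>0);
             l\<^sub>s = lambda_slow a \<sigma> \<delta>; l\<^sub>f = lambda_fast a \<sigma> \<delta>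
         in \<beta>\<^sub>f = \<delta> * l\<^sub>s\<^sup>2 / (l\<^sub>f - l\<^sub>s) * u\<^sub>0
            \<and> \<bar>\<beta>\<^sub>f\<bar> \<le> K * \<delta>\<^sup>2 * \<bar>u\<^sub>0\<bar>
            \<and> \<bar>l\<^sub>f / \<sigma> * \<beta>\<^sub>f\<bar> \<le> K * \<delta> * \<bar>u\<^sub>0\<bar>)"
  \<comment> \<open>\<open>K\<close> serves the bound on the coefficient and
    \<open>K / \<sigma>\<close> that on its product with the fast eigenvalue; the sum serves
    both.\<close>
  proof (intro exI[of _ "K + K / \<sigma>"] allI impI)
    fix u \<delta> :: real
    assume \<delta>: "0 < \<delta> \<and> \<delta> \<le> \<delta>\<^sub>0"
    then have "4 * a * \<delta> * \<sigma>\<^sup>2 < 1" using disc_mono assms by blast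
    then have eq: "fast_coeff a \<sigma> \<delta> (prepared_data a \<sigma> u) = prepared_fast a \<sigma> \<delta> u"
      using fast_coeff_prepared assms \<delta> by blast
    have "K * \<delta>\<^sup>2 * \<bar>u\<bar> \<le> (K + K / \<sigma>) * \<delta>\<^sup>2 * \<bar>u\<bar>" "K / \<sigma> * \<delta> * \<bar>u\<bar> \<le> (K + K / \<sigma>) * \<delta> * \<bar>u\<bar>"
      using K \<delta> by (intro mult_right_mono; simp)+
    then have "\<bar>prepared_fast a \<sigma> \<delta> u\<bar> \<le> (K + K / \<sigma>) * \<delta>\<^sup>2 * \<bar>u\<bar>"
      "\<bar>lambda_fast a \<sigma> \<delta> / \<sigma> * prepared_fast a \<sigma> \<delta> u\<bar> \<le> (K + K / \<sigma>) * \<delta> * \<bar>u\<bar>"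
      using prepared_fast_bounds[of a \<sigma> \<delta> \<delta>\<^sub>0 u] assms \<delta> unfolding K_def by linarith+
    then show "let \<beta>\<^sub>f = fast_coeff a \<sigma> \<delta> (prepared_data a \<sigma> u);
             l\<^sub>s = lambda_slow a \<sigma> \<delta>; l\<^sub>f = lambda_fast a \<sigma> \<delta>
         in \<beta>\<^sub>f = \<delta> * l\<^sub>s\<^sup>2 / (l\<^sub>f - l\<^sub>s) * u
            \<and> \<bar>\<beta>\<^sub>f\<bar> \<le> (K + K / \<sigma>) * \<delta>\<^sup>2 * \<bar>u\<bar>
            \<and> \<bar>l\<^sub>f / \<sigma> * \<beta>\<^sub>f\<bar> \<le> (K + K / \<sigma>) * \<delta> * \<bar>u\<bar>"
      unfolding Let_def eq by (simp only: prepared_fast_def)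
  qed
  show "\<forall>u\<^sub>0. \<exists>K. \<forall>\<delta> \<Delta>t. 0 < \<delta> \<and> \<delta> \<le> \<delta>\<^sub>0 \<and> 0 < \<Delta>t \<longrightarrow>
          max_err C a \<sigma> T \<delta> \<Delta>t (prepared_data a \<sigma> u\<^sub>0) \<le> K * (\<Delta>t + \<Delta>t ^ 4)
          \<and> max_err_u C a \<sigma> T \<delta> \<Delta>t (prepared_data a \<sigma> u\<^sub>0) \<le> K * (\<Delta>t\<^sup>2 + \<Delta>t ^ 4)"
  proof
    fix u :: real
    show "\<exists>K. \<forall>\<delta> \<Delta>t. 0 < \<delta> \<and> \<delta> \<le> \<delta>\<^sub>0 \<and> 0 < \<Delta>t \<longrightarrow>
          max_err C a \<sigma> T \<delta> \<Delta>t (prepared_data a \<sigma> u) \<le> K * (\<Delta>t + \<Delta>t ^ 4)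
          \<and> max_err_u C a \<sigma> T \<delta> \<Delta>t (prepared_data a \<sigma> u) \<le> K * (\<Delta>t\<^sup>2 + \<Delta>t ^ 4)"
      by (rule max_err_upper[OF C assms(6,1,2,4), of u]) blast
  qed
  show "\<forall>u\<^sub>0 \<kappa>. u\<^sub>0 \<noteq> 0 \<and> \<kappa> > 0 \<and> R C (- 1 / \<kappa>) \<noteq> exp (- 1 / \<kappa>) \<longrightarrow>
          (\<exists>c>0. \<forall>\<^sub>F \<Delta>t in at_right 0.
              c * \<Delta>t \<le> max_err C a \<sigma> T (\<kappa> * \<Delta>t) \<Delta>t (prepared_data a \<sigma> u\<^sub>0))
          \<and> (\<exists>c>0. \<forall>\<^sub>F \<Delta>t in at_right 0.
              c * \<Delta>t\<^sup>2 \<le> max_err_u C a \<sigma> T (\<kappa> * \<Delta>t) \<Delta>t (prepared_data a \<sigma> u\<^sub>0))"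
    using max_err_lower[OF C assms(6,1,2)] by blast
qed

end
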